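(* Let $\beta\in(1,2)$. For each $\bm u \in [ 1, (\beta-1)^{-1}]^{\mathbb N}$, it holds that $$\lim_{m \to \infty} \frac{k(m, \bm u, x)}{m} = \frac{\log 2}{\log \beta} \qquad \text{for } \lambda\text{-a.e. } x \in [0,1].$$
   Context: $\lambda$ denotes one-dimensional Lebesgue measure, and $\mathbb N=\{1,2,\dots\}$. Bits of the $\beta$-encoder. Given $\beta\in(1,2)$, a threshold sequence $\bm u=(u_n)_{n\ge1}\in[1,(\beta-1)^{-1}]^{\mathbb N}$ and $x\in[0,1]$, put $x_0=x$ and, for $n\ge 1$, let $b_n=0$ if $\beta x_{n-1}<u_n$ and $b_n=1$ if $\beta x_{n-1}\ge u_n$, and $x_n=\beta x_{n-1}-b_n$. For $k\ge1$ define the closed interval $$\mathcal I_k(\bm u,x)=\Big[\sum_{n=1}^k\frac{b_n}{\beta^n},\ \sum_{n=1}^k\frac{b_n}{\beta^n}+\frac{1}{\beta^k(\beta-1)}\Big],$$ where $b_1,\dots,b_k$ are the first $k$ bits produced from $x$ with thresholds $\bm u$. Dyadic intervals. For $m\ge1$ let $\mathcal D_m$ be the partition of $[0,1]$ into the intervals $\big[\frac{j}{2^m},\frac{j+1}{2^m}\big)$, $0\le j\le 2^m-1$, where the point $1$ is added to the last interval ($j=2^m-1$). For $x\in[0,1]$, $\mathcal D_m(x)$ denotes the unique element of $\mathcal D_m$ containing $x$. Finally, $$k(m,\bm u,x)=\inf\{k\ge1:\ \mathcal I_k(\bm u,x)\subseteq\mathcal D_m(x)\},$$ with the convention $\inf\emptyset=+\infty$.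 *)

theory Defs
  imports "HOL-Analysis.Analysis"
begin

text \<open>Threshold sequences are functions on \<open>nat\<close> of which only the values at indices
  \<open>n \<ge> 1\<close> matter; the value at \<open>0\<close> is never used.\<close>

definition threshold_seqs :: "real \<Rightarrow> (nat \<Rightarrow> real) set" where
  "threshold_seqs \<beta> = {u. \<forall>n\<ge>1. u n \<in> {1 .. 1 / (\<beta> - 1)}}"

definition quantizer :: "real \<Rightarrow> real \<Rightarrow> real" where
  "quantizer t y = (if y < t then 0 else 1)"

primrec encoder_state :: "real \<Rightarrow> (nat \<Rightarrow> real) \<Rightarrow> real \<Rightarrow> nat \<Rightarrow> real" where
  "encoder_state \<beta> u x 0 = x"
| "encoder_state \<beta> u x (Suc n) =
     \<beta> * encoder_state \<beta> u x n - quantizer (u (Suc n)) (\<beta> * encoder_state \<beta> u x n)"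

text \<open>Bit number \<open>n\<close>, meaningful for \<open>n \<ge> 1\<close>.\<close>

definition encoder_bit :: "real \<Rightarrow> (nat \<Rightarrow> real) \<Rightarrow> real \<Rightarrow> nat \<Rightarrow> real" where
  "encoder_bit \<beta> u x n = quantizer (u n) (\<beta> * encoder_state \<beta> u x (n - 1))"

definition encoder_interval :: "real \<Rightarrow> (nat \<Rightarrow> real) \<Rightarrow> real \<Rightarrow> nat \<Rightarrow> real set" where
  "encoder_interval \<beta> u x k =
     {(\<Sum>n=1..k. encoder_bit \<beta> u x n / \<beta> ^ n) ..
      (\<Sum>n=1..k. encoder_bit \<beta> u x n / \<beta> ^ n) + 1 / (\<beta> ^ k * (\<beta> - 1))}"

definition dyadic_interval :: "nat \<Rightarrow> nat \<Rightarrow> real set" where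
  "dyadic_interval m j =
     {real j / 2 ^ m ..< (real j + 1) / 2 ^ m} \<union> (if j = 2 ^ m - 1 then {1} else {})"

definition dyadic_partition :: "nat \<Rightarrow> real set set" where
  "dyadic_partition m = dyadic_interval m ` {0 .. 2 ^ m - 1}"

definition dyadic_cell :: "nat \<Rightarrow> real \<Rightarrow> real set" where
  "dyadic_cell m x = (THE D. D \<in> dyadic_partition m \<and> x \<in> D)"

text \<open>The infimum is taken in \<open>enat\<close>, where \<open>Inf {} = \<infinity>\<close>.\<close>

definition bits_needed :: "real \<Rightarrow> nat \<Rightarrow> (nat \<Rightarrow> real) \<Rightarrow> real \<Rightarrow> enat" where
  "bits_needed \<beta> m u x =
     Inf (enat ` {k. k \<ge> 1 \<and> encoder_interval \<beta> u x k \<subseteq> dyadic_cell m x})"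

lemma dyadic_interval_iff:
  assumes "x \<in> {0..1}" "j \<le> 2 ^ m - 1"
  shows "x \<in> dyadic_interval m j \<longleftrightarrow> j = (if x = 1 then 2 ^ m - 1 else nat \<lfloor>x * 2 ^ m\<rfloor>)"
proof (cases "x = 1")
  case True
  have "(real j + 1) / 2 ^ m \<le> 1"
  proof -
    have "j + 1 \<le> 2 ^ m" using assms(2) by (simp add: Suc_leI le_diff_conv2)
    hence "real (j + 1) \<le> 2 ^ m" by (metis of_nat_le_iff of_nat_numeral of_nat_power)
    thus ?thesis by simp
  qed
  thus ?thesis using True by (auto simp: dyadic_interval_def)
next
  case False
  have "x \<in> dyadic_interval m j \<longleftrightarrow> real j \<le> x * 2 ^ m \<and> x * 2 ^ m < real j + 1"
    using False by (auto simp: dyadic_interval_def field_simps)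
  also have "\<dots> \<longleftrightarrow> \<lfloor>x * 2 ^ m\<rfloor> = int j"
    by (auto simp: floor_eq_iff)
  also have "\<dots> \<longleftrightarrow> j = nat \<lfloor>x * 2 ^ m\<rfloor>"
    using assms(1) by auto
  finally show ?thesis using False by simp
qed

lemma dyadic_cell_unique:
  assumes x: "x \<in> {0..1}"
  shows "\<exists>!D. D \<in> dyadic_partition m \<and> x \<in> D"
proof -
  define j where "j = (if x = 1 then 2 ^ m - 1 else nat \<lfloor>x * 2 ^ m\<rfloor>)"
  have "j \<le> 2 ^ m - 1"
  proof (cases "x = 1")
    case False
    hence "x * 2 ^ m < 2 ^ m" using x by simp
    hence "\<lfloor>x * 2 ^ m\<rfloor> < 2 ^ m" by (simp add: floor_less_iff)
    hence "nat \<lfloor>x * 2 ^ m\<rfloor> < 2 ^ m" by (simp add: nat_less_iff)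
    hence "nat \<lfloor>x * 2 ^ m\<rfloor> \<le> 2 ^ m - 1" by linarith
    thus ?thesis using False unfolding j_def by (simp only: if_False)
  qed (simp add: j_def)
  thus ?thesis
    using dyadic_interval_iff[OF x, of _ m] unfolding dyadic_partition_def j_def[symmetric]
    by (intro ex1I[of _ "dyadic_interval m j"]) auto
qed

end

theory Submission
  imports Defs "HOL-Real_Asymp.Real_Asymp"
begin

text \<open>The interval after \<open>k\<close> bits contains \<open>x\<close> and has length \<open>1 / (\<beta> ^ k * (\<beta> - 1))\<close>. If it lies in a
  dyadic cell of length \<open>1 / 2 ^ m\<close>, comparing lengths bounds \<open>k\<close> from below. Conversely, by
  Borel--Cantelli almost every \<open>x\<close> has, for all large \<open>m\<close>, distance more than
  \<open>1 / (2 ^ m * (m + 1)\<^sup>2)\<close> from the endpoints of its cell, so the interval lies in the cell as soon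
  as its length is below this distance. Both bounds on \<open>k\<close> are \<open>m * ln 2 / ln \<beta> + O(ln m)\<close>.\<close>

text \<open>Bit 0 keeps a value below \<open>u n\<close>, hence below
  \<open>1 / (\<beta> - 1)\<close>. Bit 1 subtracts 1 from a value that is at least
  \<open>u n \<ge> 1\<close> and at most
  \<open>\<beta> / (\<beta> - 1) = 1 + 1 / (\<beta> - 1)\<close>.\<close>

lemma encoder_state_bounds:
  assumes \<beta>: "1 < \<beta>" "\<beta> < 2" and u: "u \<in> threshold_seqs \<beta>" and x: "x \<in> {0..1}"
  shows "encoder_state \<beta> u x k \<in> {0..1 / (\<beta> - 1)}"
proof (induction k)
  case 0
  have "1 \<le> 1 / (\<beta> - 1)" using \<beta> by simp
  then show ?case using x by auto
next
  case (Suc k)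
  let ?y = "\<beta> * encoder_state \<beta> u x k"
  have "?y \<le> \<beta> * (1 / (\<beta> - 1))" using Suc \<beta> by (intro mult_left_mono) auto
  also have "\<dots> = 1 + 1 / (\<beta> - 1)" using \<beta> by (simp add: field_simps)
  finally have "?y \<le> 1 + 1 / (\<beta> - 1)" .
  moreover have "0 \<le> ?y" using Suc \<beta> by simp
  moreover have "1 \<le> u (Suc k)" "u (Suc k) \<le> 1 / (\<beta> - 1)"
    using u by (auto simp: threshold_seqs_def)
  ultimately show ?case by (auto simp: quantizer_def)
qed

text \<open>Each step inverts to \<open>x_(n-1) = (b_n + x_n) / \<beta>\<close>; iterating this
  leaves the scaled state as remainder.\<close>

lemma encoder_expansion:
  assumes "\<beta> \<noteq> 0"
  shows "x = (\<Sum>n=1..k. encoder_bit \<beta> u x n / \<beta> ^ n) + encoder_state \<beta> u x k / \<beta> ^ k"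
proof (induction k)
  case (Suc k)
  have "encoder_state \<beta> u x k / \<beta> ^ k
      = encoder_bit \<beta> u x (Suc k) / \<beta> ^ Suc k + encoder_state \<beta> u x (Suc k) / \<beta> ^ Suc k"
    using assms by (simp add: encoder_bit_def field_simps)
  with Suc show ?case by simp
qed simp

text \<open>The remainder of the expansion lies between 0 and the length of the interval, so
  \<open>x\<close> belongs to the interval, and no point of it is farther from \<open>x\<close> than
  its length.\<close>

lemma encoder_interval_subset_cball:
  assumes "1 < \<beta>" "\<beta> < 2" "u \<in> threshold_seqs \<beta>" "x \<in> {0..1}"
  shows "encoder_interval \<beta> u x k \<subseteq> cball x (1 / (\<beta> ^ k * (\<beta> - 1)))"
proof -
  let ?s = "encoder_state \<beta> u x k"
  have "0 \<le> ?s" "?s \<le> 1 / (\<beta> - 1)"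
    using encoder_state_bounds[OF assms, of k] by auto
  then have "0 \<le> ?s / \<beta> ^ k" "?s / \<beta> ^ k \<le> 1 / (\<beta> - 1) / \<beta> ^ k"
    using assms by (auto intro!: divide_nonneg_pos divide_right_mono simp del: divide_divide_eq_left)
  then show ?thesis
    using encoder_expansion[of \<beta> x u k] assms
    unfolding encoder_interval_def cball_eq_atLeastAtMost by (auto simp: mult.commute)
qed

lemma dyadic_cell_cases:
  assumes "x \<in> {0..1}"
  obtains j where "j < 2 ^ m" "dyadic_cell m x = dyadic_interval m j" "x \<in> dyadic_interval m j"
proof -
  from theI'[OF dyadic_cell_unique[OF assms, of m]]
  have "dyadic_cell m x \<in> dyadic_partition m" "x \<in> dyadic_cell m x"
    unfolding dyadic_cell_def by auto
  moreover then obtain j where j: "j \<le> 2 ^ m - 1" "dyadic_cell m x = dyadic_interval m j"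
    unfolding dyadic_partition_def by auto
  moreover have "j < 2 ^ m" using j(1) by (simp add: Suc_le_lessD le_diff_conv2)
  ultimately show thesis using that by simp
qed

text \<open>The extra point 1 of the last cell is its right endpoint, so the closure covers every
  case.\<close>

lemma dyadic_interval_subset:
  assumes "j < 2 ^ m"
  shows "dyadic_interval m j \<subseteq> {real j / 2 ^ m .. (real j + 1) / 2 ^ m}"
proof -
  have "1 = (real j + 1) / 2 ^ m" if "j = 2 ^ m - 1"
    using that by (simp add: of_nat_diff)
  then show ?thesis by (auto simp: dyadic_interval_def divide_right_mono)
qed

lemma length_le_if_encoder_interval_subset:
  assumes "1 < \<beta>" "x \<in> {0..1}" "encoder_interval \<beta> u x k \<subseteq> dyadic_cell m x"
  shows "1 / (\<beta> ^ k * (\<beta> - 1)) \<le> 1 / 2 ^ m"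
proof -
  obtain j where j: "j < 2 ^ m" "dyadic_cell m x = dyadic_interval m j"
    using dyadic_cell_cases[OF assms(2)] .
  let ?a = "\<Sum>n=1..k. encoder_bit \<beta> u x n / \<beta> ^ n" and ?l = "1 / (\<beta> ^ k * (\<beta> - 1))"
  have "{?a..?a + ?l} \<subseteq> {real j / 2 ^ m .. (real j + 1) / 2 ^ m}"
    using assms(3) dyadic_interval_subset[OF j(1)] unfolding j(2) encoder_interval_def by blast
  \<comment> \<open>This makes the left interval nonempty, so that the inclusion compares
    endpoints.\<close>
  moreover have "0 \<le> ?l" using assms by simp
  ultimately show ?thesis by (auto simp: add_divide_distrib)
qed

text \<open>Both endpoints of the cell are grid points, so the ball of radius \<open>r\<close>
  around \<open>x\<close> stays strictly between them.\<close>

lemma encoder_interval_subset_if_far_from_grid: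
  assumes "1 < \<beta>" "\<beta> < 2" "u \<in> threshold_seqs \<beta>" "x \<in> {0..1}"
    and far: "\<And>i. i \<le> 2 ^ m \<Longrightarrow> r < \<bar>x - real i / 2 ^ m\<bar>"
    and r: "1 / (\<beta> ^ k * (\<beta> - 1)) \<le> r"
  shows "encoder_interval \<beta> u x k \<subseteq> dyadic_cell m x"
proof -
  obtain j where j: "j < 2 ^ m" "dyadic_cell m x = dyadic_interval m j" "x \<in> dyadic_interval m j"
    using dyadic_cell_cases[OF assms(4)] .
  have "0 \<le> 1 / (\<beta> ^ k * (\<beta> - 1))" using assms by simp
  with r have "0 \<le> r" by linarith
  moreover have "real j / 2 ^ m \<le> x" "x \<le> (real j + 1) / 2 ^ m"
    using dyadic_interval_subset[OF j(1)] j(3) by auto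
  moreover have "r < \<bar>x - real j / 2 ^ m\<bar>" "r < \<bar>x - (real j + 1) / 2 ^ m\<bar>"
    using far[of j] far[of "Suc j"] j(1) by (auto simp: add.commute)
  ultimately have "real j / 2 ^ m < x - r" "x + r < (real j + 1) / 2 ^ m"
    by linarith+
  then have "cball x (1 / (\<beta> ^ k * (\<beta> - 1))) \<subseteq> {real j / 2 ^ m ..< (real j + 1) / 2 ^ m}"
    using r unfolding cball_eq_atLeastAtMost by auto
  then show ?thesis
    using encoder_interval_subset_cball[OF assms(1-4), of k] unfolding j(2) dyadic_interval_def
    by blast
qed

text \<open>The factor \<open>(m + 1)\<^sup>2\<close> makes the measures of the exceptional sets
  summable, yet its logarithm is negligible against \<open>m\<close>.\<close>

lemma AE_eventually_far_from_grid:
  "AE x in lborel. \<forall>\<^sub>F m in sequentially.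
     \<forall>i\<le>2 ^ m. 1 / (2 ^ m * (real m + 1)\<^sup>2) < \<bar>x - real i / 2 ^ m\<bar>"
proof -
  define r where "r m = 1 / (2 ^ m * (real m + 1)\<^sup>2)" for m :: nat
  define A where "A m = (\<Union>i\<in>{..2 ^ m}. cball (real i / 2 ^ m) (r m))" for m :: nat
  have r: "0 < r m" for m by (simp add: r_def)
  have emeasure: "emeasure lborel (A m) < \<infinity>" for m
    unfolding A_def by (intro emeasure_bounded_finite bounded_UN) auto
  have measure: "measure lborel (A m) \<le> 4 * (1 / (real (Suc m))\<^sup>2)" for m
  proof -
    have "measure lborel (A m) \<le> (\<Sum>i\<in>{..2 ^ m}. measure lborel (cball (real i / 2 ^ m) (r m)))"
      unfolding A_def by (intro measure_UNION_le) (auto simp: fmeasurable_def)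
    also have "\<dots> = (2 ^ m + 1) * (2 * r m)"
      using r[of m] by (simp add: cball_eq_atLeastAtMost)
    also have "\<dots> \<le> (2 * 2 ^ m) * (2 * r m)"
      using r[of m] by (intro mult_right_mono) auto
    also have "\<dots> = 4 * (1 / (real (Suc m))\<^sup>2)"
      by (simp add: r_def add.commute)
    finally show ?thesis .
  qed
  have "summable (\<lambda>m. 1 / (real (Suc m))\<^sup>2)"
    using inverse_power_summable[of 2, where 'a = real]
    by (subst summable_Suc_iff[where f = "\<lambda>m. 1 / (real m)\<^sup>2"]) (simp add: inverse_eq_divide)
  then have "summable (\<lambda>m. 4 * (1 / (real (Suc m))\<^sup>2))"
    by (rule summable_mult)
  then have "summable (\<lambda>m. measure lborel (A m))"
    by (rule summable_comparison_test'[where N = 0]) (use measure in simp)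
  then have "AE x in lborel. \<forall>\<^sub>F m in sequentially. x \<in> space lborel - A m"
    using emeasure by (intro borel_cantelli_AE1) (auto simp: A_def)
  then show ?thesis
  proof eventually_elim
    case (elim x)
    then show ?case
      by eventually_elim (auto simp: A_def r_def dist_real_def abs_minus_commute not_le)
  qed
qed

theorem theorem1p2:
  fixes \<beta> :: real and u :: "nat \<Rightarrow> real"
  assumes "1 < \<beta>" and "\<beta> < 2"
    and "u \<in> threshold_seqs \<beta>"
  shows "AE x\<in>{0..1} in lborel.
    ((\<lambda>m. ereal_of_enat (bits_needed \<beta> m u x) / ereal (real m))
       \<longlonglongrightarrow> ereal (ln 2 / ln \<beta>))"
  using AE_eventually_far_from_grid
proof eventually_elim
  case far: (elim x)
  show ?case
  proof
    assume x: "x \<in> {0..1}"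
    define L c where "L = ln \<beta>" and "c = ln (\<beta> - 1)"
    have L: "0 < L" and c: "c < 0" using assms by (auto simp: L_def c_def)
    \<comment> \<open>The real solutions \<open>k\<close> of
      \<open>\<beta> ^ k * (\<beta> - 1) = 2 ^ m\<close> and of
      \<open>\<beta> ^ k * (\<beta> - 1) = 2 ^ m * (m + 1)\<^sup>2\<close>.\<close>
    define lo hi where "lo m = (real m * ln 2 - c) / L"
      and "hi m = (real m * ln 2 + 2 * ln (real m + 1) - c) / L" for m :: nat
    have ln_pow: "ln (\<beta> ^ k * (\<beta> - 1)) = real k * L + c" for k
      using assms by (simp add: L_def c_def ln_mult ln_realpow)
    have "\<forall>\<^sub>F m in sequentially. \<exists>K. bits_needed \<beta> m u x = enat K
        \<and> lo m \<le> real K \<and> real K \<le> hi m + 1"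
      using far
    proof eventually_elim
      case (elim m)
      let ?S = "{k. k \<ge> 1 \<and> encoder_interval \<beta> u x k \<subseteq> dyadic_cell m x}"
      define k where "k = nat \<lceil>hi m\<rceil>"
      have "0 \<le> real m * ln 2 + 2 * ln (real m + 1)" by simp
      \<comment> \<open>Positivity, which comes from \<open>c < 0\<close>, ensures that rounding up
        gives an admissible index \<open>k \<ge> 1\<close>.\<close>
      then have "0 < hi m" unfolding hi_def using L c by (intro divide_pos_pos) linarith+
      then have k: "1 \<le> k" "hi m \<le> real k" "real k \<le> hi m + 1" unfolding k_def by linarith+
      have "ln (2 ^ m * (real m + 1)\<^sup>2) = real m * ln 2 + 2 * ln (real m + 1)"
        by (simp add: ln_mult ln_realpow)
      also have "\<dots> = hi m * L + c" using L by (simp add: hi_def)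
      also have "\<dots> \<le> ln (\<beta> ^ k * (\<beta> - 1))" using k(2) L by (simp add: ln_pow)
      finally have "2 ^ m * (real m + 1)\<^sup>2 \<le> \<beta> ^ k * (\<beta> - 1)"
        using assms by (subst (asm) ln_le_cancel_iff) auto
      then have "1 / (\<beta> ^ k * (\<beta> - 1)) \<le> 1 / (2 ^ m * (real m + 1)\<^sup>2)"
        by (intro divide_left_mono mult_pos_pos) (use assms in auto)
      then have kS: "k \<in> ?S"
        using encoder_interval_subset_if_far_from_grid[OF assms x] elim k(1) by blast
      \<comment> \<open>The infimum is attained, so the minimal index \<open>K\<close> itself
        satisfies the length bound.\<close>
      have "Inf (enat ` ?S) \<in> enat ` ?S" using kS by (intro wellorder_InfI) auto
      then obtain K where K: "K \<in> ?S" "Inf (enat ` ?S) = enat K" by auto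
      have "Inf (enat ` ?S) \<le> enat k" using kS by (intro Inf_lower) auto
      then have "real K \<le> hi m + 1" using k(3) K(2) by simp
      moreover have "2 ^ m \<le> \<beta> ^ K * (\<beta> - 1)"
        using length_le_if_encoder_interval_subset[OF assms(1) x, of u K m] K(1) assms
        by (auto simp: field_simps)
      then have "ln (2 ^ m) \<le> ln (\<beta> ^ K * (\<beta> - 1))" using assms by (subst ln_le_cancel_iff) auto
      then have "real m * ln 2 - c \<le> real K * L" unfolding ln_pow by (simp add: ln_realpow)
      then have "lo m \<le> real K" using L by (simp add: lo_def pos_divide_le_eq)
      ultimately show ?case using K(2) unfolding bits_needed_def by blast
    qed
    then have bounds: "\<forall>\<^sub>F m in sequentially.
        ereal (lo m / real m) \<le> ereal_of_enat (bits_needed \<beta> m u x) / ereal (real m)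
        \<and> ereal_of_enat (bits_needed \<beta> m u x) / ereal (real m) \<le> ereal ((hi m + 1) / real m)"
      \<comment> \<open>For \<open>m > 0\<close> the extended quotient agrees with the real one; at
        \<open>m = 0\<close> the two conventions for division differ.\<close>
      using eventually_gt_at_top[of 0]
      by eventually_elim (auto simp: divide_right_mono)
    have "(\<lambda>m. lo m / real m) \<longlonglongrightarrow> ln 2 / L" "(\<lambda>m. (hi m + 1) / real m) \<longlonglongrightarrow> ln 2 / L"
      unfolding lo_def hi_def using L by (real_asymp simp: divide_inverse)+
    then have "(\<lambda>m. ereal (lo m / real m)) \<longlonglongrightarrow> ereal (ln 2 / L)"
      "(\<lambda>m. ereal ((hi m + 1) / real m)) \<longlonglongrightarrow> ereal (ln 2 / L)" by auto
    then show "(\<lambda>m. ereal_of_enat (bits_needed \<beta> m u x) / ereal (real m)) \<longlonglongrightarrow> ereal (ln 2 / ln \<beta>)"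
      unfolding L_def[symmetric]
      by (rule tendsto_sandwich[rotated 2]) (use bounds in \<open>auto elim: eventually_mono\<close>)
  qed
qed

end
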